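(* For all integers $m\ge 0$ and $n\ge 1$, writing $U_k=T_{k}^{(s_{1,0}^{(n)},s_{1,1}^{(n)},s_{1,2}^{(n)})}$ and $V^{(j)}_k=T_{k}^{(s_{1,0}^{(jn)},s_{1,1}^{(jn)},s_{1,2}^{(jn)})}$ for $j=2,3,4$, \begin{align*} \frac{1}{(A_1^{(n)})^4}\sum_{\substack{k_1+k_2+k_3+k_4=m\\ k_1,k_2,k_3,k_4\ge 0}}\binom{m}{k_1,k_2,k_3,k_4}U_{k_1}U_{k_2}U_{k_3}U_{k_4} &=-\frac{6\cdot 4^m}{A_1^{(4n)}}V^{(4)}_m +\frac{4}{A_1^{(3n)} A_1^{(n)}}\sum_{k=0}^m\binom{m}{k}3^{k}V^{(3)}_k U_{m-k}\\ &\quad +\frac{3}{(A_1^{(2n)})^2}\sum_{k=0}^m\binom{m}{k}2^{m}V^{(2)}_kV^{(2)}_{m-k} +\frac{12}{44^nA_1^{(n)}}\sum_{k=0}^m\binom{m}{k}U_k. \end{align*}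
   Context: Let $\alpha,\beta,\gamma$ be the three distinct complex roots of $x^3-x^2-x-1=0$, and set $c_1=\frac{\alpha}{(\alpha-\beta)(\alpha-\gamma)}$, $c_2=\frac{\beta}{(\beta-\alpha)(\beta-\gamma)}$, $c_3=\frac{\gamma}{(\gamma-\alpha)(\gamma-\beta)}$. For numbers $s_0,s_1,s_2$, the sequence $T_k^{(s_0,s_1,s_2)}$ is defined by $T_0^{(s_0,s_1,s_2)}=s_0$, $T_1^{(s_0,s_1,s_2)}=s_1$, $T_2^{(s_0,s_1,s_2)}=s_2$ and $T_k^{(s_0,s_1,s_2)}=T_{k-1}^{(s_0,s_1,s_2)}+T_{k-2}^{(s_0,s_1,s_2)}+T_{k-3}^{(s_0,s_1,s_2)}$ for $k\ge3$. For each integer $N\ge1$, let $A_1^{(N)}\neq0$ and $s_{1,0}^{(N)},s_{1,1}^{(N)},s_{1,2}^{(N)}$ be numbers such that $c_1^Ne^{\alpha x}+c_2^Ne^{\beta x}+c_3^Ne^{\gamma x}=\frac{1}{A_1^{(N)}}\sum_{k\ge0}T_k^{(s_{1,0}^{(N)},s_{1,1}^{(N)},s_{1,2}^{(N)})}\frac{x^k}{k!}$ (in the paper these are specific integer normalizations). $\binom{m}{k_1,\dots,k_r}=\frac{m!}{k_1!\cdots k_r!}$ is the multinomial coefficient. *)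

theory Defs
  imports "HOL-Analysis.Analysis"
begin

fun tribonacci :: "'a::plus \<Rightarrow> 'a \<Rightarrow> 'a \<Rightarrow> nat \<Rightarrow> 'a" where
  "tribonacci s0 s1 s2 0 = s0"
| "tribonacci s0 s1 s2 (Suc 0) = s1"
| "tribonacci s0 s1 s2 (Suc (Suc 0)) = s2"
| "tribonacci s0 s1 s2 (Suc (Suc (Suc k))) =
     tribonacci s0 s1 s2 (Suc (Suc k)) + tribonacci s0 s1 s2 (Suc k) + tribonacci s0 s1 s2 k"

text \<open>The quotient is meant for lists \<open>ks\<close> with \<open>sum_list ks = m\<close>.\<close>

definition multinomial :: "nat \<Rightarrow> nat list \<Rightarrow> 'a::field_char_0" where
  "multinomial m ks = fact m / (\<Prod>k\<leftarrow>ks. fact k)"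

end

theory Submission
  imports Defs "HOL-Complex_Analysis.Laurent_Convergence"
begin

text \<open>
  Put \<open>a = c1 ^ n * exp (\<alpha> x)\<close>, and \<open>b\<close>, \<open>c\<close> likewise. The exponential generating functions of
  \<open>U\<close> and of \<open>k \<mapsto> j ^ k * V j k\<close> are, up to the normalizing constants, the power sums
  \<open>a + b + c\<close> and \<open>a ^ j + b ^ j + c ^ j\<close>. By Vieta \<open>\<alpha> + \<beta> + \<gamma> = 1\<close>, and \<open>c1 * c2 * c3 = 1 / 44\<close> because
  the cubic has discriminant \<open>-44\<close>; hence \<open>a * b * c = exp x / 44 ^ n\<close>. The theorem is the
  \<open>m\<close>-th coefficient of Newton's identity \<open>p1^4 = -6 p4 + 4 p3 p1 + 3 p2^2 + 12 a b c p1\<close>.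
\<close>

definition egf :: "(nat \<Rightarrow> 'a::field_char_0) \<Rightarrow> 'a fps" where
  "egf f = Abs_fps (\<lambda>k. f k / fact k)"

lemma egf_nth [simp]: "fps_nth (egf f) k = f k / fact k"
  by (simp add: egf_def)

lemma egf_eq_iff: "egf f = egf g \<longleftrightarrow> f = g"
  by (auto simp: fps_eq_iff)

lemma fps_exp_eq_egf: "fps_exp a = egf (\<lambda>k. a ^ k)"
  by (simp add: fps_eq_iff)

lemma egf_add: "egf f + egf g = egf (\<lambda>k. f k + g k)"
  by (simp add: fps_eq_iff add_divide_distrib)

lemma fps_const_mult_egf: "fps_const a * egf f = egf (\<lambda>k. a * f k)"
  by (simp add: fps_eq_iff)

lemma egf_mult:
  "egf f * egf g = egf (\<lambda>m. \<Sum>k=0..m. of_nat (m choose k) * f k * g (m - k))"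
  by (auto simp: fps_eq_iff fps_mult_nth sum_divide_distrib binomial_fact intro!: sum.cong)

lemma egf_mult_dilated:
  "egf (\<lambda>k. r ^ k * f k) * egf (\<lambda>k. r ^ k * g k) =
    egf (\<lambda>m. \<Sum>k=0..m. of_nat (m choose k) * r ^ m * f k * g (m - k))"
proof -
  have "r ^ m = r ^ k * r ^ (m - k)" if "k \<le> m" for k m
    using that by (simp flip: power_add)
  then show ?thesis
    by (auto simp: egf_mult egf_eq_iff mult_ac intro!: ext sum.cong)
qed

lemma egf_power:
  "egf f ^ r = egf (\<lambda>m. \<Sum>ks\<in>natpermute m r. multinomial m ks * (\<Prod>k\<leftarrow>ks. f k))"
proof (cases r)
  case 0
  then show ?thesis
    by (auto simp: fps_eq_iff natpermute_0 multinomial_def)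
next
  case (Suc q)
  have prod_nth: "(\<Prod>i=0..q. fps_nth (egf f) (ks ! i)) = (\<Prod>k\<leftarrow>ks. f k) / (\<Prod>k\<leftarrow>ks. fact k)"
    if "ks \<in> natpermute m (q + 1)" for ks m
  proof -
    have "{0..q} = {0..<length ks}"
      using that by (auto simp: natpermute_def)
    then show ?thesis
      by (simp add: prod.list_conv_set_nth prod_dividef)
  qed
  show ?thesis
  proof (rule fps_ext)
    fix m
    have "fps_nth (egf f ^ r) m = (\<Sum>ks\<in>natpermute m r. (\<Prod>k\<leftarrow>ks. f k) / (\<Prod>k\<leftarrow>ks. fact k))"
      unfolding Suc fps_power_nth_Suc by (simp add: prod_nth del: egf_nth)
    then show "fps_nth (egf f ^ r) m =
        fps_nth (egf (\<lambda>m. \<Sum>ks\<in>natpermute m r. multinomial m ks * (\<Prod>k\<leftarrow>ks. f k))) m"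
      by (simp add: multinomial_def sum_divide_distrib)
  qed
qed

lemma sum_natpermute_4:
  "(\<Sum>ks\<in>natpermute m 4. g ks) =
    (\<Sum>(k1, k2, k3, k4) \<in> {(k1, k2, k3, k4). k1 + k2 + k3 + k4 = m}. g [k1, k2, k3, k4])"
  by (rule sum.reindex_bij_witness[where i = "\<lambda>(k1, k2, k3, k4). [k1, k2, k3, k4]"
        and j = "\<lambda>ks. (ks ! 0, ks ! 1, ks ! 2, ks ! 3)"])
    (auto simp: natpermute_def numeral_eq_Suc length_Suc_conv)

definition binet_sum :: "('a \<times> 'a) list \<Rightarrow> nat \<Rightarrow> nat \<Rightarrow> 'a::comm_semiring_1" where
  "binet_sum cs n k = (\<Sum>(c, a)\<leftarrow>cs. c ^ n * a ^ k)"

lemma egf_dilated_binet_sum: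
  "egf (\<lambda>k. of_nat j ^ k * binet_sum cs (j * n) k) =
    (\<Sum>(c, a)\<leftarrow>cs. (fps_const (c ^ n) * fps_exp a) ^ j)"
proof (induction cs)
  case Nil
  show ?case
    by (simp add: binet_sum_def fps_eq_iff)
next
  case (Cons ca cs)
  obtain c a where ca: "ca = (c, a)"
    by (cases ca)
  have "(fps_const (c ^ n) * fps_exp a) ^ j = egf (\<lambda>k. of_nat j ^ k * (c ^ (j * n) * a ^ k))"
    by (simp add: fps_eq_iff power_mult_distrib fps_exp_power_mult mult_ac flip: power_mult)
  then show ?case
    by (simp add: ca binet_sum_def distrib_left egf_add flip: Cons.IH)
qed

lemma sums_exp_imp_eq_binet_sum:
  fixes f :: "nat \<Rightarrow> complex"
  assumes "\<And>x. (\<lambda>k. f k / fact k * x ^ k) sums (\<Sum>(c, a)\<leftarrow>cs. c ^ n * exp (a * x))"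
  shows "f k = binet_sum cs n k"
proof -
  have "(\<lambda>x. \<Sum>(c, a)\<leftarrow>cs. c ^ n * exp (a * x)) has_fps_expansion egf f"
    using assms by (intro has_fps_expansionI) simp
  moreover have "(\<lambda>x. \<Sum>(c, a)\<leftarrow>cs. c ^ n * exp (a * x)) has_fps_expansion
      (\<Sum>(c, a)\<leftarrow>cs. fps_const (c ^ n) * fps_exp a)"
    by (induction cs) (auto intro!: fps_expansion_intros simp del: fps_const_power)
  then have "(\<lambda>x. \<Sum>(c, a)\<leftarrow>cs. c ^ n * exp (a * x)) has_fps_expansion egf (binet_sum cs n)"
    using egf_dilated_binet_sum[of 1 cs n] by simp
  ultimately have "egf f = egf (binet_sum cs n)"
    by (rule fps_expansion_unique_complex)
  then show ?thesis
    by (simp add: egf_eq_iff)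
qed

lemma power4_sum3_eq_power_sums:
  fixes a b c :: "'a::comm_ring_1"
  shows "(a + b + c) ^ 4 = - 6 * (a ^ 4 + b ^ 4 + c ^ 4) + 4 * ((a ^ 3 + b ^ 3 + c ^ 3) * (a + b + c))
    + 3 * ((a ^ 2 + b ^ 2 + c ^ 2) * (a ^ 2 + b ^ 2 + c ^ 2)) + 12 * (a * b * c * (a + b + c))"
  by (simp add: algebra_simps eval_nat_numeral)

lemma binet_sum_fourfold_convolution:
  fixes c1 c2 c3 \<alpha> \<beta> \<gamma> :: "'a::field_char_0"
  defines "W \<equiv> binet_sum [(c1, \<alpha>), (c2, \<beta>), (c3, \<gamma>)]"
  shows "(\<Sum>ks\<in>natpermute m 4. multinomial m ks * (\<Prod>k\<leftarrow>ks. W n k)) =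
    - 6 * (4 ^ m * W (4 * n) m)
    + 4 * (\<Sum>k=0..m. of_nat (m choose k) * (3 ^ k * W (3 * n) k) * W n (m - k))
    + 3 * (\<Sum>k=0..m. of_nat (m choose k) * 2 ^ m * W (2 * n) k * W (2 * n) (m - k))
    + 12 * (c1 * c2 * c3) ^ n * (\<Sum>k=0..m. of_nat (m choose k) * W n k * (\<alpha> + \<beta> + \<gamma>) ^ (m - k))"
    (is "?L m = ?R m")
proof -
  define a b c where "a = fps_const (c1 ^ n) * fps_exp \<alpha>" and "b = fps_const (c2 ^ n) * fps_exp \<beta>"
    and "c = fps_const (c3 ^ n) * fps_exp \<gamma>"
  have power_sum: "a ^ j + b ^ j + c ^ j = egf (\<lambda>k. of_nat j ^ k * W (j * n) k)" for j
    by (simp add: W_def a_def b_def c_def egf_dilated_binet_sum add.assoc)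
  have p1: "a + b + c = egf (W n)"
    using power_sum[of 1] by simp
  have abc: "a * b * c = fps_const ((c1 * c2 * c3) ^ n) * egf (\<lambda>k. (\<alpha> + \<beta> + \<gamma>) ^ k)"
    by (simp add: a_def b_def c_def power_mult_distrib fps_exp_add_mult mult_ac
        flip: fps_const_mult fps_exp_eq_egf)
  have abc_p1: "fps_const 12 * (a * b * c * egf (W n)) =
      fps_const (12 * (c1 * c2 * c3) ^ n) * (egf (W n) * egf (\<lambda>k. (\<alpha> + \<beta> + \<gamma>) ^ k))"
    unfolding abc by (simp add: mult_ac flip: fps_const_mult)
  have "egf ?L = (a + b + c) ^ 4"
    by (simp add: p1 egf_power)
  also have "\<dots> = fps_const (- 6) * (a ^ 4 + b ^ 4 + c ^ 4)
      + fps_const 4 * ((a ^ 3 + b ^ 3 + c ^ 3) * (a + b + c))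
      + fps_const 3 * ((a ^ 2 + b ^ 2 + c ^ 2) * (a ^ 2 + b ^ 2 + c ^ 2))
      + fps_const 12 * (a * b * c * (a + b + c))"
    unfolding power4_sum3_eq_power_sums by (simp add: numeral_fps_const)
  also have "\<dots> = egf ?R"
    by (simp only: p1 abc_p1 power_sum of_nat_numeral egf_mult_dilated)
      (simp only: egf_mult fps_const_mult_egf egf_add)
  finally show ?thesis
    by (simp only: egf_eq_iff fun_eq_iff)
qed

lemma monic_cubic_vieta:
  fixes x y z :: "'a::idom"
  assumes "x ^ 3 + p * x ^ 2 + q * x + r = 0" "y ^ 3 + p * y ^ 2 + q * y + r = 0"
    "z ^ 3 + p * z ^ 2 + q * z + r = 0"
    and "x \<noteq> y" "x \<noteq> z" "y \<noteq> z"
  shows "x + y + z = - p" "x * y + x * z + y * z = q" "x * y * z = - r"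
proof -
  have "(x - y) * (x\<^sup>2 + x * y + y\<^sup>2 + p * (x + y) + q) = 0"
    using assms(1,2) by algebra
  then have xy: "x\<^sup>2 + x * y + y\<^sup>2 + p * (x + y) + q = 0"
    using \<open>x \<noteq> y\<close> by simp
  have "(x - z) * (x\<^sup>2 + x * z + z\<^sup>2 + p * (x + z) + q) = 0"
    using assms(1,3) by algebra
  then have xz: "x\<^sup>2 + x * z + z\<^sup>2 + p * (x + z) + q = 0"
    using \<open>x \<noteq> z\<close> by simp
  have "(y - z) * (x + y + z + p) = 0"
    using xy xz by algebra
  then show sum: "x + y + z = - p"
    using \<open>y \<noteq> z\<close> by (simp add: eq_neg_iff_add_eq_0)
  show sum_prod: "x * y + x * z + y * z = q"
    using xy sum by algebra
  show "x * y * z = - r"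
    using assms(1) sum sum_prod by algebra
qed

text \<open>The right-hand side is minus the discriminant of \<open>X ^ 3 - s X ^ 2 + t X - u\<close>.\<close>

lemma cubic_prod_root_differences:
  fixes x y z :: "'a::comm_ring_1"
  assumes "x + y + z = s" "x * y + x * z + y * z = t" "x * y * z = u"
  shows "((x - y) * (x - z)) * ((y - x) * (y - z)) * ((z - x) * (z - y)) =
    4 * s ^ 3 * u + 4 * t ^ 3 + 27 * u ^ 2 - s ^ 2 * t ^ 2 - 18 * s * t * u"
  unfolding assms[symmetric] by (simp add: algebra_simps eval_nat_numeral)

theorem theorem9:
  fixes \<alpha> \<beta> \<gamma> c1 c2 c3 :: complex
    and A s0 s1 s2 :: "nat \<Rightarrow> complex"
    and U :: "nat \<Rightarrow> complex" and V :: "nat \<Rightarrow> nat \<Rightarrow> complex"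
    and m n :: nat
  assumes roots: "{x::complex. x ^ 3 - x ^ 2 - x - 1 = 0} = {\<alpha>, \<beta>, \<gamma>}"
    and distinct: "\<alpha> \<noteq> \<beta>" "\<alpha> \<noteq> \<gamma>" "\<beta> \<noteq> \<gamma>"
    and c1: "c1 = \<alpha> / ((\<alpha> - \<beta>) * (\<alpha> - \<gamma>))"
    and c2: "c2 = \<beta> / ((\<beta> - \<alpha>) * (\<beta> - \<gamma>))"
    and c3: "c3 = \<gamma> / ((\<gamma> - \<alpha>) * (\<gamma> - \<beta>))"
    and A_nonzero: "\<And>N. N \<ge> 1 \<Longrightarrow> A N \<noteq> 0"
    and gen: "\<And>N x. N \<ge> 1 \<Longrightarrow>
      (\<lambda>k. 1 / A N * (tribonacci (s0 N) (s1 N) (s2 N) k * (x ^ k / fact k))) sums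
      (c1 ^ N * exp (\<alpha> * x) + c2 ^ N * exp (\<beta> * x) + c3 ^ N * exp (\<gamma> * x))"
    and n: "n \<ge> 1"
    and U: "\<And>k. U k = tribonacci (s0 n) (s1 n) (s2 n) k"
    and V: "\<And>j k. j \<in> {2, 3, 4} \<Longrightarrow>
      V j k = tribonacci (s0 (j * n)) (s1 (j * n)) (s2 (j * n)) k"
  shows "1 / A n ^ 4 *
      (\<Sum>(k1, k2, k3, k4) \<in> {(k1, k2, k3, k4). k1 + k2 + k3 + k4 = m}.
        multinomial m [k1, k2, k3, k4] * U k1 * U k2 * U k3 * U k4)
    = - (6 * 4 ^ m / A (4 * n)) * V 4 m
      + 4 / (A (3 * n) * A n) * (\<Sum>k=0..m. of_nat (m choose k) * 3 ^ k * V 3 k * U (m - k))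
      + 3 / (A (2 * n)) ^ 2 * (\<Sum>k=0..m. of_nat (m choose k) * 2 ^ m * V 2 k * V 2 (m - k))
      + 12 / (44 ^ n * A n) * (\<Sum>k=0..m. of_nat (m choose k) * U k)"
proof -
  have root: "x ^ 3 + (- 1) * x ^ 2 + (- 1) * x + (- 1) = 0" if "x \<in> {\<alpha>, \<beta>, \<gamma>}" for x
    using that unfolding roots[symmetric] by simp
  note vieta = monic_cubic_vieta[OF root root root distinct, simplified]
  have c_prod: "c1 * c2 * c3 = 1 / 44"
    unfolding c1 c2 c3 times_divide_times_eq cubic_prod_root_differences[OF vieta] by (simp add: vieta)
  define W where "W = binet_sum [(c1, \<alpha>), (c2, \<beta>), (c3, \<gamma>)]"
  have W: "W N k = tribonacci (s0 N) (s1 N) (s2 N) k / A N" if "N \<ge> 1" for N k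
    unfolding W_def
  proof (rule sums_exp_imp_eq_binet_sum[symmetric])
    fix x
    show "(\<lambda>k. tribonacci (s0 N) (s1 N) (s2 N) k / A N / fact k * x ^ k) sums
        (\<Sum>(c, a)\<leftarrow>[(c1, \<alpha>), (c2, \<beta>), (c3, \<gamma>)]. c ^ N * exp (a * x))"
      using gen[OF that, of x] by (simp add: mult_ac add_ac)
  qed
  have W_U: "W n k = U k / A n" for k
    using n by (simp add: U W)
  have W_V: "W (2 * n) k = V 2 k / A (2 * n)" "W (3 * n) k = V 3 k / A (3 * n)"
    "W (4 * n) k = V 4 k / A (4 * n)" for k
    using n by (simp_all add: V W)
  from binet_sum_fourfold_convolution[of m c1 \<alpha> c2 \<beta> c3 \<gamma> n, folded W_def]
  show ?thesis
    unfolding W_U W_V c_prod vieta sum_natpermute_4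
    by (simp add: sum_distrib_left sum_divide_distrib case_prod_unfold power_one_over
        power4_eq_xxxx power2_eq_square mult_ac)
qed

end
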